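(* Let $R$ be a ring and $a\in R$. If $a$ has a generalized Hirano inverse, then $a$ has a generalized Drazin inverse.
   Context: Rings are associative with identity; $U(R)$ is the group of units of $R$. For $a\in R$: $comm(a)=\{x\in R : xa=ax\}$ and $comm^2(a)=\{x\in R : xy=yx \text{ for all } y\in comm(a)\}$. $R^{qnil}=\{a\in R : 1+ax\in U(R)\text{ for every }x\in comm(a)\}$. An element $a\in R$ has a generalized Hirano inverse if there exists $b\in R$ such that $b=bab$, $b\in comm^2(a)$ and $a^2-ab\in R^{qnil}$. An element $a\in R$ has a generalized Drazin inverse if there exists $b\in R$ such that $b=bab$, $b\in comm^2(a)$ and $a-a^2b\in R^{qnil}$. *)

theory Defs
  imports "HOL-Algebra.Ring"
begin

text \<open>
  Rings are the associative, unital, not necessarily commutative rings of the locale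
  \<^locale>\<open>ring\<close>; the zero ring is allowed. The group of units is \<^const>\<open>Units\<close>.
\<close>

definition commutant :: "('a, 'm) ring_scheme \<Rightarrow> 'a \<Rightarrow> 'a set" where
  "commutant R a = {x \<in> carrier R. x \<otimes>\<^bsub>R\<^esub> a = a \<otimes>\<^bsub>R\<^esub> x}"

definition double_commutant :: "('a, 'm) ring_scheme \<Rightarrow> 'a \<Rightarrow> 'a set" where
  "double_commutant R a =
     {x \<in> carrier R. \<forall>y \<in> commutant R a. x \<otimes>\<^bsub>R\<^esub> y = y \<otimes>\<^bsub>R\<^esub> x}"

definition quasinilpotents :: "('a, 'm) ring_scheme \<Rightarrow> 'a set" where
  "quasinilpotents R =
     {a \<in> carrier R. \<forall>x \<in> commutant R a. \<one>\<^bsub>R\<^esub> \<oplus>\<^bsub>R\<^esub> a \<otimes>\<^bsub>R\<^esub> x \<in> Units R}"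

definition has_generalized_Hirano_inverse :: "('a, 'm) ring_scheme \<Rightarrow> 'a \<Rightarrow> bool" where
  "has_generalized_Hirano_inverse R a \<longleftrightarrow>
     (\<exists>b \<in> carrier R. b = b \<otimes>\<^bsub>R\<^esub> a \<otimes>\<^bsub>R\<^esub> b \<and> b \<in> double_commutant R a \<and>
        a [^]\<^bsub>R\<^esub> (2::nat) \<ominus>\<^bsub>R\<^esub> a \<otimes>\<^bsub>R\<^esub> b \<in> quasinilpotents R)"

definition has_generalized_Drazin_inverse :: "('a, 'm) ring_scheme \<Rightarrow> 'a \<Rightarrow> bool" where
  "has_generalized_Drazin_inverse R a \<longleftrightarrow>
     (\<exists>b \<in> carrier R. b = b \<otimes>\<^bsub>R\<^esub> a \<otimes>\<^bsub>R\<^esub> b \<and> b \<in> double_commutant R a \<and>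
        a \<ominus>\<^bsub>R\<^esub> a [^]\<^bsub>R\<^esub> (2::nat) \<otimes>\<^bsub>R\<^esub> b \<in> quasinilpotents R)"

end

theory Submission imports Defs begin

text \<open>
  The Hirano inverse \<open>b\<close> is itself a Drazin inverse. Put \<open>e = ab\<close>, an idempotent commuting
  with \<open>a\<close>, and \<open>f = 1 - e\<close>, so that \<open>a - a\<^sup>2b = af\<close>. If \<open>x\<close> commutes with \<open>af\<close>, then the corner
  element \<open>y = fxf\<close> commutes with \<open>a\<close> itself (hence also with \<open>b\<close>) and \<open>afx = ay\<close>. Since
  \<open>ey = 0\<close>, we get \<open>(1 - ay)(1 + ay) = 1 - a\<^sup>2y\<^sup>2 = 1 - (a\<^sup>2 - ab)y\<^sup>2\<close>, a unit because
  \<open>a\<^sup>2 - ab\<close> is quasinilpotent and commutes with \<open>y\<^sup>2\<close>.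
\<close>

text \<open>With \<open>w\<close> inverse to \<open>u \<otimes> v\<close>, commutativity makes
  \<open>v \<otimes> w\<close> a right and \<open>w \<otimes> v\<close> a left inverse of
  \<open>u\<close>; the two must coincide.\<close>

lemma (in monoid) Units_of_commuting_product:
  assumes u: "u \<in> carrier G" and v: "v \<in> carrier G"
    and comm: "u \<otimes> v = v \<otimes> u" and unit: "u \<otimes> v \<in> Units G"
  shows "u \<in> Units G"
proof -
  define w where "w = inv (u \<otimes> v)"
  have w: "w \<in> carrier G" unfolding w_def using unit by simp
  have r: "u \<otimes> (v \<otimes> w) = \<one>"
    using unit u v w by (simp add: w_def m_assoc[symmetric])
  have l: "(w \<otimes> v) \<otimes> u = \<one>"
    using unit u v w by (simp add: w_def m_assoc comm[symmetric])
  have "w \<otimes> v = v \<otimes> w"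
    using inv_unique[OF l r] u v w by simp
  with l r show ?thesis
    unfolding Units_def using u v w by auto
qed

context ring
begin

text \<open>The difference-of-squares step, isolated from the origin of \<open>y\<close> as a corner
  element.\<close>

lemma unit_one_plus_of_quasinilpotent_square:
  assumes a: "a \<in> carrier R" and b: "b \<in> carrier R" and y: "y \<in> carrier R"
    and ya: "y \<otimes> a = a \<otimes> y" and yb: "y \<otimes> b = b \<otimes> y"
    and aby: "a \<otimes> b \<otimes> y = \<zero>"
    and qnil: "a \<otimes> a \<ominus> a \<otimes> b \<in> quasinilpotents R"
  shows "\<one> \<oplus> a \<otimes> y \<in> Units R"
proof -
  define q where "q = a \<otimes> a \<ominus> a \<otimes> b"
  have q: "q \<in> carrier R" using a b by (simp add: q_def)
  have y_mult: "y \<otimes> (s \<otimes> t) = (s \<otimes> t) \<otimes> y"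
    if "s \<in> carrier R" "t \<in> carrier R" "y \<otimes> s = s \<otimes> y" "y \<otimes> t = t \<otimes> y" for s t
    using that y by (metis m_assoc m_closed)
  have yq: "y \<otimes> q = q \<otimes> y"
    using a b y y_mult[OF a a ya ya] y_mult[OF a b ya yb]
    by (simp add: q_def minus_eq l_distr r_distr l_minus r_minus)
  have "(y \<otimes> y) \<otimes> q = q \<otimes> (y \<otimes> y)"
    using y q yq by (metis m_assoc m_closed)
  \<comment> \<open>The sign turns the form \<open>1 + qx\<close> in the definition of
    quasinilpotence into \<open>1 - qyy\<close>.\<close>
  then have "\<ominus> (y \<otimes> y) \<in> commutant R q"
    using y q by (simp add: commutant_def l_minus r_minus)
  then have unit: "\<one> \<oplus> q \<otimes> (\<ominus> (y \<otimes> y)) \<in> Units R"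
    using qnil unfolding quasinilpotents_def q_def by blast
  \<comment> \<open>Since \<open>a \<otimes> b\<close> annihilates \<open>y\<close>, multiplying
    \<open>y\<close> by \<open>q\<close> is the same as multiplying it by
    \<open>a \<otimes> a\<close>.\<close>
  have "q \<otimes> y = a \<otimes> a \<otimes> y"
    using a b y aby by (simp add: q_def minus_eq l_distr l_minus)
  then have "q \<otimes> (y \<otimes> y) = a \<otimes> a \<otimes> y \<otimes> y"
    using y q by (simp add: m_assoc[symmetric])
  also have "\<dots> = (a \<otimes> y) \<otimes> (a \<otimes> y)"
    using a y ya by (metis m_assoc m_closed)
  finally have qyy: "q \<otimes> (y \<otimes> y) = (a \<otimes> y) \<otimes> (a \<otimes> y)" .
  define z where "z = a \<otimes> y"
  have z: "z \<in> carrier R" using a y by (simp add: z_def)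
  have prod: "(\<one> \<oplus> z) \<otimes> (\<one> \<ominus> z) = \<one> \<oplus> \<ominus> (z \<otimes> z)"
    using z by (simp add: minus_eq l_distr r_distr r_minus minus_add a_assoc r_neg1 r_neg2)
  have "(\<one> \<ominus> z) \<otimes> (\<one> \<oplus> z) = \<one> \<oplus> \<ominus> (z \<otimes> z)"
    using z by (simp add: minus_eq l_distr r_distr l_minus a_assoc r_neg1 r_neg2)
  with prod have comm: "(\<one> \<oplus> z) \<otimes> (\<one> \<ominus> z) = (\<one> \<ominus> z) \<otimes> (\<one> \<oplus> z)" by simp
  have "(\<one> \<oplus> z) \<otimes> (\<one> \<ominus> z) \<in> Units R"
    using unit qyy y q unfolding prod by (simp add: r_minus z_def)
  then show ?thesis
    using Units_of_commuting_product[OF _ _ comm] z by (simp add: z_def)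
qed

text \<open>Both notions share the first two conditions on \<open>b\<close>, so with the same
  \<open>b\<close> only the quasinilpotence of \<open>a - aab\<close> is at stake.\<close>

lemma generalized_Hirano_imp_generalized_Drazin:
  assumes a: "a \<in> carrier R" and H: "has_generalized_Hirano_inverse R a"
  shows "has_generalized_Drazin_inverse R a"
proof -
  from H obtain b where b: "b \<in> carrier R" and bab: "b = b \<otimes> a \<otimes> b"
    and dc: "b \<in> double_commutant R a"
    and "a [^] (2::nat) \<ominus> a \<otimes> b \<in> quasinilpotents R"
    unfolding has_generalized_Hirano_inverse_def by blast
  then have qnil: "a \<otimes> a \<ominus> a \<otimes> b \<in> quasinilpotents R"
    using a by (simp add: numeral_2_eq_2)
  have b_comm: "y \<otimes> b = b \<otimes> y" if "y \<in> carrier R" "y \<otimes> a = a \<otimes> y" for y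
    using dc that by (auto simp: double_commutant_def commutant_def)
  have ab: "a \<otimes> b = b \<otimes> a" using b_comm a by simp
  define f where "f = \<one> \<ominus> a \<otimes> b"
  have f: "f \<in> carrier R" using a b by (simp add: f_def)
  have abab: "a \<otimes> b \<otimes> (a \<otimes> b) = a \<otimes> b"
    using bab a b by (metis m_assoc m_closed)
  have abf: "a \<otimes> b \<otimes> f = \<zero>"
    using a b abab by (simp add: f_def minus_eq r_distr r_minus r_neg)
  \<comment> \<open>Only the left factor is expanded, so that \<open>abf\<close> removes the second
    term.\<close>
  have ff: "f \<otimes> f = f"
    using a b f abf by (subst (1) f_def) (simp add: minus_eq l_distr l_minus)
  have fa: "f \<otimes> a = a \<otimes> f"
    using a b m_assoc[OF a b a]
    by (simp add: f_def minus_eq l_distr r_distr l_minus r_minus ab)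
  define p where "p = a \<otimes> f"
  have p: "p \<in> carrier R" using a f by (simp add: p_def)
  \<comment> \<open>\<open>f\<close> is a two-sided identity for \<open>p\<close>; this lets the
    outer factors of \<open>fxf\<close> be absorbed below.\<close>
  have pf: "p \<otimes> f = p" using a f ff by (simp add: p_def m_assoc)
  have fp: "f \<otimes> p = p"
    using a f ff fa by (simp add: p_def m_assoc[symmetric]) (simp add: m_assoc)
  have "\<one> \<oplus> p \<otimes> x \<in> Units R" if "x \<in> commutant R p" for x
  proof -
    from that have x: "x \<in> carrier R" and xp: "x \<otimes> p = p \<otimes> x"
      by (auto simp: commutant_def)
    define y where "y = f \<otimes> x \<otimes> f"
    have y: "y \<in> carrier R" using f x by (simp add: y_def)
    \<comment> \<open>Moving \<open>x\<close> past \<open>p\<close> brings \<open>p\<close> next to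
      the remaining \<open>f\<close>, which it absorbs. The mirror argument for
      \<open>y \<otimes> a\<close> ends in the same \<open>p \<otimes> x\<close>, whence
      \<open>y\<close> commutes with \<open>a\<close>.\<close>
    have "a \<otimes> y = p \<otimes> x \<otimes> f"
      using a f x by (simp add: y_def p_def m_assoc)
    also have "\<dots> = x \<otimes> (p \<otimes> f)"
      using f x p xp by (simp add: m_assoc[symmetric])
    finally have ay: "a \<otimes> y = p \<otimes> x" using pf xp by simp
    have "y \<otimes> a = f \<otimes> (x \<otimes> p)"
      using a f x fa by (simp add: y_def p_def m_assoc)
    also have "\<dots> = p \<otimes> x"
      using f x p xp fp by (simp add: m_assoc[symmetric])
    finally have ya: "y \<otimes> a = a \<otimes> y" using ay by simp
    have "a \<otimes> b \<otimes> y = (a \<otimes> b \<otimes> f) \<otimes> (x \<otimes> f)"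
      using a b f x by (simp add: y_def m_assoc)
    then have "a \<otimes> b \<otimes> y = \<zero>" using abf x f by simp
    then show ?thesis
      using unit_one_plus_of_quasinilpotent_square[OF a b y ya b_comm[OF y ya] _ qnil] ay
      by simp
  qed
  then have "p \<in> quasinilpotents R" using p by (simp add: quasinilpotents_def)
  moreover have "a \<ominus> a [^] (2::nat) \<otimes> b = p"
    using a b by (simp add: p_def f_def numeral_2_eq_2 minus_eq r_distr r_minus m_assoc)
  ultimately show ?thesis
    unfolding has_generalized_Drazin_inverse_def using b bab dc by metis
qed

end

theorem theorem2p2:
  fixes R :: "('a, 'm) ring_scheme" and a :: 'a
  assumes "ring R"
    and "a \<in> carrier R"
    and "has_generalized_Hirano_inverse R a"
  shows "has_generalized_Drazin_inverse R a"
  using ring.generalized_Hirano_imp_generalized_Drazin[OF assms] .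

end
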